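(* For each $n\in\mathbb{N}$, we have $$\mathrm{Out}(\Omega,n)=\{u\in\mathbb{N} \mid u\geq \Omega(n)\}.$$ Consequently, $\mathrm{Out}(\Omega,n)$ is a cofinite subset of $\mathbb{N}$ for every $n\in\mathbb{N}$, and $\mathrm{Out}(\Omega,n)=\mathbb{N}$ if and only if $n=1$ or $n$ is a prime.
   Context: $\mathbb{N}$ denotes the set of positive integers. For $m\in\mathbb{N}$, $\Omega(m)$ is the number of prime divisors of $m$ counted with multiplicity (so $\Omega(1)=0$). For an arithmetic function $g$ and $n\in\mathbb{N}$, $\mathrm{Out}(g,n)$ is the set of all $u\in\mathbb{N}$ for which there exists a positive integer $N$ such that $n\mid N$ and $g(N)=u$. A subset of $\mathbb{N}$ is cofinite if its complement in $\mathbb{N}$ is finite. *)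

theory Defs
  imports "HOL-Computational_Algebra.Primes"
begin

(* The set of positive integers; the type nat also contains 0. *)
definition pos_nats :: "nat set" where
  "pos_nats = {u. u > 0}"

(* prime_factorization m is the multiset of prime divisors of m, so size counts multiplicity. *)
definition bigomega :: "nat \<Rightarrow> nat" where
  "bigomega m = size (prime_factorization m)"

(* Only positive arguments of g matter. Values u = 0 are excluded, although g may attain 0,
   as bigomega does at 1. *)
definition Out :: "(nat \<Rightarrow> nat) \<Rightarrow> nat \<Rightarrow> nat set" where
  "Out g n = {u \<in> pos_nats. \<exists>N \<in> pos_nats. n dvd N \<and> g N = u}"

definition cofinite_subset :: "nat set \<Rightarrow> bool" where
  "cofinite_subset A \<longleftrightarrow> A \<subseteq> pos_nats \<and> finite (pos_nats - A)"

end

theory Submission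
  imports Defs
begin

text \<open>Everything rests on additivity (\<open>bigomega_mult\<close>). A positive multiple
  \<open>n * k\<close> has value \<open>bigomega n + bigomega k\<close>, so nothing below
  \<open>bigomega n\<close> is attained; a factor \<open>k = 2 ^ j\<close> contributes exactly
  \<open>j\<close>, so every positive value from there on is attained (\<open>Out_bigomega\<close>).
  The set is thus a tail of the positive integers, missing only finitely many, and it misses none
  exactly when its threshold is at most 1 (\<open>bigomega_le_1_iff\<close>).\<close>

lemma bigomega_mult:
  assumes "m > 0" "n > 0"
  shows "bigomega (m * n) = bigomega m + bigomega n"
  using assms by (simp add: bigomega_def prime_factorization_mult)

lemma bigomega_prime_power:
  assumes "prime p"
  shows "bigomega (p ^ k) = k"
  using assms by (simp add: bigomega_def prime_factorization_prime_power)

text \<open>A positive integer is the product of its multiset of prime factors, so an empty multiset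
  forces 1 and a singleton forces a prime. The cases 0 and 1 are treated together because 0 is not a
  positive integer: both thresholds cut out the same set.\<close>

lemma bigomega_le_1_iff:
  assumes "n > 0"
  shows "bigomega n \<le> 1 \<longleftrightarrow> n = 1 \<or> prime n"
proof
  assume "bigomega n \<le> 1"
  then consider "size (prime_factorization n) = 0" | "size (prime_factorization n) = 1"
    unfolding bigomega_def by linarith
  then show "n = 1 \<or> prime n"
  proof cases
    case 1
    with assms show ?thesis by (simp add: prime_factorization_empty_iff)
  next
    case 2
    then obtain p where p: "prime_factorization n = {#p#}"
      by (metis One_nat_def size_1_singleton_mset)
    have "prime p"
      using p in_prime_factors_imp_prime[of p n] by simp
    moreover have "n = p"
      using prod_mset_prime_factorization_nat[of n] assms p by simp
    ultimately show ?thesis by simp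
  qed
next
  assume "n = 1 \<or> prime n"
  then show "bigomega n \<le> 1"
    by (auto simp: bigomega_def prime_factorization_prime)
qed

lemma Out_bigomega:
  assumes "n > 0"
  shows "Out bigomega n = {u \<in> pos_nats. u \<ge> bigomega n}"
proof (intro set_eqI iffI)
  fix u assume "u \<in> Out bigomega n"
  then show "u \<in> {u \<in> pos_nats. u \<ge> bigomega n}"
    \<comment> \<open>With \<open>N = n * k\<close>, positivity of \<open>N\<close> gives
      \<open>k > 0\<close>, so additivity applies.\<close>
    using assms by (auto simp: Out_def pos_nats_def bigomega_mult)
next
  fix u assume u: "u \<in> {u \<in> pos_nats. u \<ge> bigomega n}"
  \<comment> \<open>Pad \<open>n\<close> with as many factors 2 as are lacking; the subtraction does
    not truncate, since \<open>u \<ge> bigomega n\<close>.\<close>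
  let ?N = "n * 2 ^ (u - bigomega n)"
  have "bigomega ?N = u"
    using u assms by (simp add: bigomega_mult bigomega_prime_power)
  moreover have "?N \<in> pos_nats" "n dvd ?N"
    using assms by (simp_all add: pos_nats_def)
  ultimately show "u \<in> Out bigomega n"
    using u unfolding Out_def by blast
qed

theorem theorem9:
  shows "(\<forall>n \<in> pos_nats. Out bigomega n = {u \<in> pos_nats. u \<ge> bigomega n}) \<and>
    (\<forall>n \<in> pos_nats. cofinite_subset (Out bigomega n)) \<and>
    (\<forall>n \<in> pos_nats. Out bigomega n = pos_nats \<longleftrightarrow> n = 1 \<or> prime n)"
proof (intro conjI ballI)
  fix n :: nat assume "n \<in> pos_nats"
  then have n: "n > 0" by (simp add: pos_nats_def)
  show out: "Out bigomega n = {u \<in> pos_nats. u \<ge> bigomega n}"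
    by (rule Out_bigomega[OF n])
  have "pos_nats - Out bigomega n \<subseteq> {..<bigomega n}"
    unfolding out by auto
  then have "finite (pos_nats - Out bigomega n)"
    by (rule finite_subset) simp
  moreover have "Out bigomega n \<subseteq> pos_nats"
    by (auto simp: Out_def)
  ultimately show "cofinite_subset (Out bigomega n)"
    by (simp add: cofinite_subset_def)
  have "Out bigomega n = pos_nats \<longleftrightarrow> (\<forall>u>0. bigomega n \<le> u)"
    unfolding out pos_nats_def by auto
  \<comment> \<open>The least positive value \<open>u = 1\<close> is the decisive instance.\<close>
  also have "\<dots> \<longleftrightarrow> bigomega n \<le> 1"
    by (auto intro: order_trans[of _ 1])
  also have "\<dots> \<longleftrightarrow> n = 1 \<or> prime n"
    by (rule bigomega_le_1_iff[OF n])
  finally show "Out bigomega n = pos_nats \<longleftrightarrow> n = 1 \<or> prime n" .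
qed

end
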